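(* Let $G$ be a graph with vertex set $\{v_1,\ldots,v_n\}$ and let $H$ be the bipartite graph with vertex set $\{u_1,\ldots,u_n\}\cup\{w_1,\ldots,w_n\}$ and edge set $\{u_iw_j,u_jw_i: v_iv_j\in E(G)\}\cup\{u_iw_i:1\leq i\leq n\}$. If $G$ has an interval total $t$-coloring, then $H$ has an interval $t$-coloring.
   Context: All graphs are finite, undirected, without loops or multiple edges. A total coloring of a graph $G$ is an assignment of colors to the vertices and edges of $G$ such that no two adjacent vertices, no two adjacent edges, and no vertex and an edge incident to it receive the same color. For a positive integer $t$, an interval total $t$-coloring of $G$ is a total coloring of $G$ with colors $1,2,\ldots,t$ such that each color $i\in\{1,\ldots,t\}$ is used on at least one vertex or edge, and for each vertex $v$ the set consisting of the color of $v$ and the colors of the edges incident to $v$ consists of $d_G(v)+1$ consecutive integers, where $d_G(v)$ is the degree of $v$. An interval $t$-coloring of a graph is a proper edge-coloring with colors $1,\ldots,t$ in which each color $i\in\{1,\ldots,t\}$ is used on at least one edge and the edges incident to each vertex $v$ receive $d(v)$ consecutive colors. *)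

theory Defs
  imports Main
begin

text \<open>An undirected edge is the two-element set of its endpoints.\<close>

locale simple_graph =
  fixes V :: "'a set" and E :: "'a set set"
  assumes finite_V: "finite V"
    and edges: "e \<in> E \<Longrightarrow> e \<subseteq> V \<and> card e = 2"

definition incident_edges :: "'a set set \<Rightarrow> 'a \<Rightarrow> 'a set set" where
  "incident_edges E v = {e \<in> E. v \<in> e}"

definition degree :: "'a set set \<Rightarrow> 'a \<Rightarrow> nat" where
  "degree E v = card (incident_edges E v)"

definition consecutive :: "nat \<Rightarrow> nat set \<Rightarrow> bool" where
  "consecutive m S \<longleftrightarrow> (\<exists>k. S = {k..<k + m})"

definition proper_edge_coloring :: "'a set set \<Rightarrow> ('a set \<Rightarrow> nat) \<Rightarrow> bool" where
  "proper_edge_coloring E c \<longleftrightarrow>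
     (\<forall>e\<in>E. \<forall>e'\<in>E. e \<noteq> e' \<and> e \<inter> e' \<noteq> {} \<longrightarrow> c e \<noteq> c e')"

text \<open>A total coloring is given by its restrictions \<open>f\<close> to the vertices and \<open>g\<close> to the edges.\<close>

definition total_coloring ::
  "'a set \<Rightarrow> 'a set set \<Rightarrow> ('a \<Rightarrow> nat) \<Rightarrow> ('a set \<Rightarrow> nat) \<Rightarrow> bool" where
  "total_coloring V E f g \<longleftrightarrow>
     (\<forall>x\<in>V. \<forall>y\<in>V. {x, y} \<in> E \<longrightarrow> f x \<noteq> f y) \<and>
     proper_edge_coloring E g \<and>
     (\<forall>x\<in>V. \<forall>e\<in>E. x \<in> e \<longrightarrow> f x \<noteq> g e)"

text \<open>
  In the next two definitions the equation with \<open>{1..t}\<close> says both that all colors lie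
  in \<open>{1..t}\<close> and that every color in \<open>{1..t}\<close> is used.
\<close>

definition interval_total_coloring ::
  "'a set \<Rightarrow> 'a set set \<Rightarrow> nat \<Rightarrow> ('a \<Rightarrow> nat) \<Rightarrow> ('a set \<Rightarrow> nat) \<Rightarrow> bool" where
  "interval_total_coloring V E t f g \<longleftrightarrow>
     total_coloring V E f g \<and>
     f ` V \<union> g ` E = {1..t} \<and>
     (\<forall>x\<in>V. consecutive (degree E x + 1) (insert (f x) (g ` incident_edges E x)))"

definition interval_coloring :: "'a set \<Rightarrow> 'a set set \<Rightarrow> nat \<Rightarrow> ('a set \<Rightarrow> nat) \<Rightarrow> bool" where
  "interval_coloring V E t c \<longleftrightarrow>
     proper_edge_coloring E c \<and>
     c ` E = {1..t} \<and>
     (\<forall>x\<in>V. consecutive (degree E x) (c ` incident_edges E x))"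

text \<open>
  The graph \<open>H\<close> built from a graph with edge set \<open>E\<close> and vertices \<open>v 1, \<dots>, v n\<close>; the vertices
  \<open>u 1, \<dots>, u n, w 1, \<dots>, w n\<close> are meant to be pairwise distinct.
\<close>

definition H_verts :: "nat \<Rightarrow> (nat \<Rightarrow> 'b) \<Rightarrow> (nat \<Rightarrow> 'b) \<Rightarrow> 'b set" where
  "H_verts n u w = u ` {1..n} \<union> w ` {1..n}"

definition H_edges ::
  "nat \<Rightarrow> 'a set set \<Rightarrow> (nat \<Rightarrow> 'a) \<Rightarrow> (nat \<Rightarrow> 'b) \<Rightarrow> (nat \<Rightarrow> 'b) \<Rightarrow> 'b set set" where
  "H_edges n E v u w =
     (\<Union>i\<in>{1..n}. \<Union>j\<in>{j \<in> {1..n}. {v i, v j} \<in> E}. {{u i, w j}, {u j, w i}}) \<union>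
     {{u i, w i} | i. i \<in> {1..n}}"

lemma simple_graph_H:
  assumes "u ` {1..n} \<inter> w ` {1..n} = {}"
  shows "simple_graph (H_verts n u w) (H_edges n E v u w)"
proof
  show "finite (H_verts n u w)"
    by (simp add: H_verts_def)
next
  have ne: "u i \<noteq> w j" if "i \<in> {1..n}" "j \<in> {1..n}" for i j
    using assms that by blast
  fix e assume "e \<in> H_edges n E v u w"
  then obtain i j where ij: "i \<in> {1..n}" "j \<in> {1..n}" "e = {u i, w j}"
    unfolding H_edges_def by blast
  then show "e \<subseteq> H_verts n u w \<and> card e = 2"
    using ne[OF ij(1,2)] by (auto simp: H_verts_def)
qed

end

theory Submission
  imports Defs
begin

text \<open>
  Color \<open>u i w i\<close> with the color of \<open>v i\<close>, and both \<open>u i w j\<close> and \<open>u j w i\<close> with the color of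
  \<open>v i v j\<close>. Then the edges at \<open>u i\<close>, and likewise those at \<open>w i\<close>, carry exactly the colors that
  the total coloring shows at \<open>v i\<close>. Properness needs no separate argument: \<open>d\<close> edges whose
  colors form an interval of length \<open>d\<close> are colored injectively.
\<close>

lemma consecutive_card: "consecutive m S \<Longrightarrow> card S = m"
  by (auto simp: consecutive_def)

lemma proper_edge_coloring_if_consecutive:
  assumes "finite E" and "\<And>e. e \<in> E \<Longrightarrow> e \<subseteq> V"
    and cons: "\<And>x. x \<in> V \<Longrightarrow> consecutive (degree E x) (c ` incident_edges E x)"
  shows "proper_edge_coloring E c"
  unfolding proper_edge_coloring_def
proof (intro ballI impI)
  fix e e' assume e: "e \<in> E" "e' \<in> E" "e \<noteq> e' \<and> e \<inter> e' \<noteq> {}"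
  then obtain x where x: "x \<in> e" "x \<in> e'" by blast
  have "finite (incident_edges E x)"
    using assms(1) by (simp add: incident_edges_def)
  moreover have "x \<in> V" using assms(2) e(1) x(1) by blast
  ultimately have "inj_on c (incident_edges E x)"
    using consecutive_card[OF cons] by (intro eq_card_imp_inj_on) (simp_all add: degree_def)
  then show "c e \<noteq> c e'"
    using e x by (auto simp: inj_on_def incident_edges_def)
qed

text \<open>Counting \<open>i\<close> among its own neighbors puts the edge
  \<open>{u i, w i}\<close> on the same footing as the edges \<open>{u i, w j}\<close> that come
  from edges of \<open>G\<close>.\<close>

definition closed_nbrs :: "nat \<Rightarrow> 'a set set \<Rightarrow> (nat \<Rightarrow> 'a) \<Rightarrow> nat \<Rightarrow> nat set" where
  "closed_nbrs n E v i = insert i {j \<in> {1..n}. {v i, v j} \<in> E}"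

text \<open>The color intended for \<open>{u i, w j}\<close>. For distinct non-adjacent indices the
  value of \<open>g\<close> is arbitrary, which is harmless because such a pair gives no edge of
  \<open>H\<close>.\<close>

definition pair_color :: "(nat \<Rightarrow> 'a) \<Rightarrow> ('a \<Rightarrow> nat) \<Rightarrow> ('a set \<Rightarrow> nat) \<Rightarrow> nat \<Rightarrow> nat \<Rightarrow> nat" where
  "pair_color v f g i j = (if i = j then f (v i) else g {v i, v j})"

lemma pair_color_commute: "pair_color v f g i j = pair_color v f g j i"
  by (simp add: pair_color_def insert_commute)

lemma closed_nbrs_subset: "i \<in> {1..n} \<Longrightarrow> closed_nbrs n E v i \<subseteq> {1..n}"
  by (auto simp: closed_nbrs_def)

text \<open>Adjacency in \<open>G\<close> is symmetric, so \<open>{u j, w i}\<close> already occurs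
  in the list at \<open>u j\<close>; sorting the edges by their \<open>u\<close>-end therefore loses
  none.\<close>

lemma H_edges_eq:
  "H_edges n E v u w = (\<Union>i\<in>{1..n}. (\<lambda>j. {u i, w j}) ` closed_nbrs n E v i)" (is "?L = ?R")
proof
  show "?L \<subseteq> ?R"
  proof
    fix e assume "e \<in> ?L"
    then consider
        i j where "i \<in> {1..n}" "j \<in> {1..n}" "{v i, v j} \<in> E" "e = {u i, w j} \<or> e = {u j, w i}"
      | i where "i \<in> {1..n}" "e = {u i, w i}"
      unfolding H_edges_def by blast
    then show "e \<in> ?R"
    proof cases
      case 1
      then have "{v j, v i} \<in> E" by (simp add: insert_commute)
      with 1 show ?thesis unfolding closed_nbrs_def by blast
    next
      case 2
      then show ?thesis unfolding closed_nbrs_def by blast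
    qed
  qed
  show "?R \<subseteq> ?L"
    unfolding H_edges_def closed_nbrs_def by blast
qed

text \<open>This symmetry carries results proved at the vertices \<open>u i\<close> over to the
  vertices \<open>w i\<close>.\<close>

lemma H_edges_commute: "H_edges n E v u w = H_edges n E v w u"
proof -
  have "{{u i, w j}, {u j, w i}} = {{w i, u j}, {w j, u i}}" for i j
    by blast
  moreover have "{u i, w i} = {w i, u i}" for i
    by (rule insert_commute)
  ultimately show ?thesis
    unfolding H_edges_def by (simp only:)
qed

text \<open>Disjointness forces \<open>u i\<close> to be the \<open>u\<close>-end of any edge
  containing it, and injectivity of \<open>u\<close> then determines the index of that end.\<close>

lemma incident_edges_H_edges:
  assumes "inj_on u {1..n}" and "u ` {1..n} \<inter> w ` {1..n} = {}" and i: "i \<in> {1..n}"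
  shows "incident_edges (H_edges n E v u w) (u i) = (\<lambda>j. {u i, w j}) ` closed_nbrs n E v i"
    (is "?L = ?R")
proof
  show "?L \<subseteq> ?R"
  proof
    fix e assume "e \<in> ?L"
    then obtain i' j where e: "i' \<in> {1..n}" "j \<in> closed_nbrs n E v i'" "e = {u i', w j}"
      and "u i \<in> e"
      unfolding incident_edges_def H_edges_eq by blast
    moreover have "u i \<noteq> w j"
      using assms(2) i closed_nbrs_subset e(1,2) by blast
    ultimately have "u i = u i'" by blast
    then have "i = i'" using assms(1) i e(1) by (simp add: inj_on_eq_iff)
    then show "e \<in> ?R" using e by blast
  qed
  show "?R \<subseteq> ?L"
    using i unfolding incident_edges_def H_edges_eq by blast
qed

context simple_graph
begin

lemma finite_E: "finite E"
  using finite_V edges by (intro finite_subset[of E "Pow V"]) auto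

lemma no_loop: "{x} \<notin> E"
  using edges[of "{x}"] by auto

lemma incident_edges_eq_image:
  assumes v: "bij_betw v {1..n} V" and i: "i \<in> {1..n}"
  shows "incident_edges E (v i) = (\<lambda>j. {v i, v j}) ` {j \<in> {1..n}. {v i, v j} \<in> E}"
    (is "?L = ?R")
proof
  show "?L \<subseteq> ?R"
  proof
    fix e assume e: "e \<in> ?L"
    then have "e \<in> E" "v i \<in> e" by (auto simp: incident_edges_def)
    from edges[OF this(1)] obtain a b where "e = {a, b}"
      unfolding card_2_iff by blast
    with \<open>v i \<in> e\<close> obtain y where y: "e = {v i, y}" by blast
    with \<open>e \<in> E\<close> have "y \<in> V" using edges by blast
    then obtain j where "j \<in> {1..n}" "y = v j"
      using bij_betw_imp_surj_on[OF v] by blast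
    with y \<open>e \<in> E\<close> show "e \<in> ?R" by blast
  qed
qed (auto simp: incident_edges_def)

lemma card_closed_nbrs:
  assumes v: "bij_betw v {1..n} V" and i: "i \<in> {1..n}"
  shows "card (closed_nbrs n E v i) = degree E (v i) + 1"
proof -
  have "inj_on (\<lambda>j. {v i, v j}) {j \<in> {1..n}. {v i, v j} \<in> E}"
  proof (rule inj_onI)
    fix j j' assume "j \<in> {j \<in> {1..n}. {v i, v j} \<in> E}" "j' \<in> {j \<in> {1..n}. {v i, v j} \<in> E}"
      and "{v i, v j} = {v i, v j'}"
    then have "v j = v j'" "j \<in> {1..n}" "j' \<in> {1..n}" by (simp_all add: doubleton_eq_iff) metis
    then show "j = j'" using bij_betw_imp_inj_on[OF v] by (simp only: inj_on_eq_iff)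
  qed
  then have "degree E (v i) = card {j \<in> {1..n}. {v i, v j} \<in> E}"
    by (simp add: degree_def incident_edges_eq_image[OF assms] card_image)
  \<comment> \<open>The summand 1 is \<open>i\<close> itself: it is not among the neighbors, since
    \<open>{v i, v i}\<close> would be a loop.\<close>
  then show ?thesis
    using no_loop[of "v i"] by (simp add: closed_nbrs_def)
qed

lemma pair_color_image_closed_nbrs:
  assumes v: "bij_betw v {1..n} V" and i: "i \<in> {1..n}"
  shows "pair_color v f g i ` closed_nbrs n E v i = insert (f (v i)) (g ` incident_edges E (v i))"
proof -
  \<comment> \<open>Without loops a neighbor \<open>j\<close> differs from \<open>i\<close>, so only
    the edge branch of \<open>pair_color\<close> occurs here.\<close>
  have "pair_color v f g i ` {j \<in> {1..n}. {v i, v j} \<in> E}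
      = (\<lambda>j. g {v i, v j}) ` {j \<in> {1..n}. {v i, v j} \<in> E}"
    by (intro image_cong) (auto simp: pair_color_def no_loop)
  moreover have "pair_color v f g i i = f (v i)" by (simp add: pair_color_def)
  ultimately show ?thesis
    by (simp only: closed_nbrs_def image_insert incident_edges_eq_image[OF assms] image_image)
qed

text \<open>The degree of \<open>u i\<close> in \<open>H\<close> is one more than that of
  \<open>v i\<close> in \<open>G\<close>, which is exactly the length of the interval that the total
  coloring shows at \<open>v i\<close>. Since \<open>u\<close> and \<open>w\<close> are arbitrary,
  the lemma can also be used with their roles exchanged.\<close>

lemma consecutive_H_edges:
  assumes v: "bij_betw v {1..n} V"
    and "inj_on u {1..n}" and "inj_on w {1..n}" and "u ` {1..n} \<inter> w ` {1..n} = {}"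
    and fg: "interval_total_coloring V E t f g"
    and c: "\<And>i j. i \<in> {1..n} \<Longrightarrow> j \<in> {1..n} \<Longrightarrow> c {u i, w j} = pair_color v f g i j"
    and i: "i \<in> {1..n}"
  shows "consecutive (degree (H_edges n E v u w) (u i)) (c ` incident_edges (H_edges n E v u w) (u i))"
proof -
  note inc = incident_edges_H_edges[OF assms(2,4) i, where E = E and v = v]
  have sub: "closed_nbrs n E v i \<subseteq> {1..n}" by (rule closed_nbrs_subset[OF i])
  have "inj_on w (closed_nbrs n E v i)"
    using assms(3) sub by (rule inj_on_subset)
  then have "inj_on (\<lambda>j. {u i, w j}) (closed_nbrs n E v i)"
    by (intro inj_onI) (metis doubleton_eq_iff inj_onD)
  then have "degree (H_edges n E v u w) (u i) = degree E (v i) + 1"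
    by (simp add: degree_def inc card_image card_closed_nbrs[OF v i, unfolded degree_def])
  moreover have "c ` incident_edges (H_edges n E v u w) (u i)
      = pair_color v f g i ` closed_nbrs n E v i"
    unfolding inc image_image using c i sub by (intro image_cong) auto
  moreover have "v i \<in> V" using v i by (rule bij_betwE[THEN bspec])
  ultimately show ?thesis
    using fg by (simp add: pair_color_image_closed_nbrs[OF v i] interval_total_coloring_def)
qed

text \<open>Collect the colors by \<open>u\<close>-ends: index \<open>i\<close> contributes the
  color of \<open>v i\<close> and those of the edges at \<open>v i\<close>. Every edge of
  \<open>G\<close> has an end in \<open>V\<close>, so no color of \<open>G\<close> is
  missed.\<close>

lemma color_image_H_edges:
  assumes v: "bij_betw v {1..n} V"
    and c: "\<And>i j. i \<in> {1..n} \<Longrightarrow> j \<in> {1..n} \<Longrightarrow> c {u i, w j} = pair_color v f g i j"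
  shows "c ` H_edges n E v u w = f ` V \<union> g ` E"
proof -
  have "c ` H_edges n E v u w = (\<Union>i\<in>{1..n}. (\<lambda>j. c {u i, w j}) ` closed_nbrs n E v i)"
    by (simp add: H_edges_eq image_UN image_image)
  also have "\<dots> = (\<Union>i\<in>{1..n}. pair_color v f g i ` closed_nbrs n E v i)"
    using c closed_nbrs_subset by (intro SUP_cong image_cong refl) blast
  also have "\<dots> = (\<Union>i\<in>{1..n}. insert (f (v i)) (g ` incident_edges E (v i)))"
    by (intro SUP_cong refl pair_color_image_closed_nbrs[OF v])
  also have "\<dots> = (\<Union>x\<in>v ` {1..n}. insert (f x) (g ` incident_edges E x))"
    by simp
  also have "\<dots> = (\<Union>x\<in>V. insert (f x) (g ` incident_edges E x))"
    by (simp only: bij_betw_imp_surj_on[OF v])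
  also have "\<dots> = f ` V \<union> g ` (\<Union>x\<in>V. incident_edges E x)"
    by blast
  also have "(\<Union>x\<in>V. incident_edges E x) = E"
  proof -
    have "\<exists>x\<in>V. x \<in> e" if "e \<in> E" for e
      using edges[OF that] by (auto simp: card_2_iff)
    then show ?thesis by (auto simp: incident_edges_def)
  qed
  finally show ?thesis .
qed

end

text \<open>Colorings are functions on sets, so prescribing them on index pairs requires that an
  edge \<open>{u i, w j}\<close> determine \<open>i\<close> and \<open>j\<close>.\<close>

lemma edge_function_exists:
  assumes u: "inj_on u I" and w: "inj_on w J" and disj: "u ` I \<inter> w ` J = {}"
  obtains c where "\<And>i j. i \<in> I \<Longrightarrow> j \<in> J \<Longrightarrow> c {u i, w j} = k i j"
proof
  fix i j assume ij: "i \<in> I" "j \<in> J"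
  have "{u i, w j} \<inter> u ` I = {u i}" "{u i, w j} \<inter> w ` J = {w j}"
    using ij disj by auto
  \<comment> \<open>The witness cuts \<open>e\<close> down to its single element on each side and
    reads off the index there; on other sets its value does not matter.\<close>
  then show "(\<lambda>e. k (the_inv_into I u (the_elem (e \<inter> u ` I)))
      (the_inv_into J w (the_elem (e \<inter> w ` J)))) {u i, w j} = k i j"
    using u w ij by (simp only: the_elem_eq the_inv_into_f_f)
qed

theorem theorem3:
  fixes V :: "'a set" and E :: "'a set set" and n t :: nat
    and v :: "nat \<Rightarrow> 'a" and u w :: "nat \<Rightarrow> 'b"
  assumes "simple_graph V E"
    and "bij_betw v {1..n} V"
    and "inj_on u {1..n}" and "inj_on w {1..n}" and "u ` {1..n} \<inter> w ` {1..n} = {}"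
    and "t \<ge> 1"
    and "\<exists>f g. interval_total_coloring V E t f g"
  shows "\<exists>c. interval_coloring (H_verts n u w) (H_edges n E v u w) t c"
proof -
  interpret G: simple_graph V E by fact
  interpret H: simple_graph "H_verts n u w" "H_edges n E v u w"
    using assms(5) by (rule simple_graph_H)
  obtain f g where fg: "interval_total_coloring V E t f g"
    using assms(7) by blast
  obtain c where c: "\<And>i j. i \<in> {1..n} \<Longrightarrow> j \<in> {1..n} \<Longrightarrow> c {u i, w j} = pair_color v f g i j"
    using edge_function_exists[OF assms(3-5), where k = "pair_color v f g"] by blast
  \<comment> \<open>Symmetry of \<open>pair_color\<close> lets the same \<open>c\<close> meet the
    color condition with \<open>u\<close> and \<open>w\<close> exchanged.\<close>
  have c': "c {w i, u j} = pair_color v f g i j" if "i \<in> {1..n}" "j \<in> {1..n}" for i j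
    using c[OF that(2,1)] by (simp add: insert_commute pair_color_commute)
  have disj': "w ` {1..n} \<inter> u ` {1..n} = {}" using assms(5) by blast
  have cons: "consecutive (degree (H_edges n E v u w) x) (c ` incident_edges (H_edges n E v u w) x)"
    if x: "x \<in> H_verts n u w" for x
  proof -
    consider i where "i \<in> {1..n}" "x = u i" | i where "i \<in> {1..n}" "x = w i"
      using x by (auto simp: H_verts_def)
    then show ?thesis
    proof cases
      case 1
      then show ?thesis
        using G.consecutive_H_edges[where c = c, OF assms(2-5) fg c] by simp
    next
      \<comment> \<open>With \<open>u\<close> and \<open>w\<close> exchanged, the lemma speaks of
        \<open>H_edges n E v w u\<close>, which is the same edge set.\<close>
      case 2
      then show ?thesis
        using G.consecutive_H_edges[where c = c, OF assms(2,4,3) disj' fg c']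
        by (simp add: H_edges_commute[of n E v u w])
    qed
  qed
  have "proper_edge_coloring (H_edges n E v u w) c"
    using H.finite_E H.edges[THEN conjunct1] cons by (rule proper_edge_coloring_if_consecutive)
  moreover have "c ` H_edges n E v u w = {1..t}"
    using G.color_image_H_edges[where c = c, OF assms(2) c] fg
    by (simp add: interval_total_coloring_def)
  ultimately show ?thesis
    using cons unfolding interval_coloring_def by blast
qed

end
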